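(* Let $y$ be a square-integrable function of $\mathbf{X}$ with generalized ADD $y(\mathbf{X})=\sum_{u\subseteq\{1,\dots,N\}}y_{u,G}(\mathbf{X}_u)$. Then the generalized ADD component functions $y_{u,G}$, where $\emptyset\neq u\subseteq\{1,\dots,N\}$, have zero means, i.e., $$\mathbb{E}\left[y_{u,G}(\mathbf{X}_u)\right]=0 .$$
   Context: Let $N\in\mathbb{N}$ and let $\mathbf{X}=(X_1,\dots,X_N)$ be an $\mathbb{R}^N$-valued random vector on a complete probability space, with joint probability density function $f_{\mathbf{X}}:\mathbb{R}^N\to[0,\infty)$, not necessarily of product type. For $u\subseteq\{1,\dots,N\}$, $|u|$ is its cardinality, $-u:=\{1,\dots,N\}\setminus u$, $\mathbf{X}_u=(X_i)_{i\in u}$ and $\mathbf{x}_u=(x_i)_{i\in u}$. For $u\neq\emptyset$ the marginal density of $\mathbf{X}_u$ is $f_u(\mathbf{x}_u):=\int_{\mathbb{R}^{N-|u|}}f_{\mathbf{X}}(\mathbf{x})\,d\mathbf{x}_{-u}$. The support of $f_{\mathbf{X}}$ is assumed grid-closed: for any point $\mathbf{x}\in\mathrm{supp}(f_{\mathbf{X}})$ one can traverse in each coordinate direction and find another point $\mathbf{x}'\in\mathrm{supp}(f_{\mathbf{X}})$. Generalized ADD (ANOVA dimensional decomposition): the decomposition $y(\mathbf{X})=\sum_{u\subseteq\{1,\dots,N\}}y_{u,G}(\mathbf{X}_u)$ of a square-integrable function $y$ (that is, $\mathbb{E}[y(\mathbf{X})^2]<\infty$), where $y_{\emptyset,G}$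 is a constant, each $y_{u,G}$ with $u\ne\emptyset$ is a function of $\mathbf{x}_u$ with $\int_{\mathbb{R}^{|u|}}y_{u,G}^2(\mathbf{x}_u)f_u(\mathbf{x}_u)\,d\mathbf{x}_u<\infty$, and the weak annihilating conditions hold: $$\int_{\mathbb{R}}y_{u,G}(\mathbf{x}_u)f_u(\mathbf{x}_u)\,dx_i=0\quad\text{for every } i\in u\neq\emptyset$$ (for almost every value of the remaining variables $x_j$, $j\in u\setminus\{i\}$). *)

theory Defs
  imports "HOL-Probability.Probability"
begin

text \<open>
  Points of \<open>\<real>\<^bsup>|u|\<^esup>\<close>, for an index set \<open>u\<close>, are extensional functions on \<open>u\<close> (undefined
  outside \<open>u\<close>); the projection \<open>x\<^sub>u\<close> of \<open>x\<close> is \<open>restrict x u\<close>. For \<open>u = {}\<close> there is exactly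
  one point, and Lebesgue measure is the unit point mass on it.
\<close>

definition leb :: "nat set \<Rightarrow> (nat \<Rightarrow> real) measure" where
  "leb u = (\<Pi>\<^sub>M i\<in>u. lborel)"

definition marginal_density ::
    "nat \<Rightarrow> ((nat \<Rightarrow> real) \<Rightarrow> real) \<Rightarrow> nat set \<Rightarrow> (nat \<Rightarrow> real) \<Rightarrow> real" where
  "marginal_density N f u x =
     (\<integral>z. f (merge u ({1..N} - u) (x, z)) \<partial>leb ({1..N} - u))"

text \<open>
  The closure is taken in the product topology on all functions \<open>nat \<Rightarrow> real\<close>; the extensional
  functions on \<open>{1..N}\<close> form a closed subspace homeomorphic to \<open>\<real>\<^sup>N\<close>, so this is the usual
  closure in \<open>\<real>\<^sup>N\<close>.
\<close>

definition density_support :: "nat \<Rightarrow> ((nat \<Rightarrow> real) \<Rightarrow> real) \<Rightarrow> (nat \<Rightarrow> real) set" where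
  "density_support N f = closure {x \<in> space (leb {1..N}). f x \<noteq> 0}"

definition grid_closed :: "nat \<Rightarrow> (nat \<Rightarrow> real) set \<Rightarrow> bool" where
  "grid_closed N S \<longleftrightarrow> (\<forall>x\<in>S. \<forall>i\<in>{1..N}. \<exists>t. t \<noteq> x i \<and> x(i := t) \<in> S)"

definition square_integrable_function ::
    "'a measure \<Rightarrow> nat \<Rightarrow> ('a \<Rightarrow> nat \<Rightarrow> real) \<Rightarrow> ((nat \<Rightarrow> real) \<Rightarrow> real) \<Rightarrow> bool" where
  "square_integrable_function M N X y \<longleftrightarrow>
     y \<in> borel_measurable (leb {1..N}) \<and> integrable M (\<lambda>\<omega>. (y (X \<omega>))\<^sup>2)"

text \<open>
  If \<open>x\<close> is a point indexed by \<open>u - {i}\<close>, then \<open>x(i := t)\<close> is the point indexed by \<open>u\<close> with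
  \<open>i\<close>-th coordinate \<open>t\<close>. When \<open>g\<^sup>2 f\<^sub>u\<close> is integrable, so is \<open>g f\<^sub>u\<close> (as \<open>f\<^sub>u\<close> has integral 1),
  hence for almost every \<open>x\<close> the inner integral below is a genuine one; integrability need not
  be demanded separately.
\<close>

definition weak_annihilating ::
    "nat \<Rightarrow> ((nat \<Rightarrow> real) \<Rightarrow> real) \<Rightarrow> nat set \<Rightarrow> ((nat \<Rightarrow> real) \<Rightarrow> real) \<Rightarrow> bool" where
  "weak_annihilating N f u g \<longleftrightarrow>
     (\<forall>i\<in>u. AE x in leb (u - {i}).
        (\<integral>t. g (x(i := t)) * marginal_density N f u (x(i := t)) \<partial>lborel) = 0)"

text \<open>
  The component \<open>yG {}\<close> is a constant because it is only ever evaluated at the single point of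
  \<open>leb {}\<close>. The decomposition is an identity of random variables, i.e. it holds almost surely.
\<close>

definition generalized_ADD ::
    "'a measure \<Rightarrow> nat \<Rightarrow> ('a \<Rightarrow> nat \<Rightarrow> real) \<Rightarrow> ((nat \<Rightarrow> real) \<Rightarrow> real) \<Rightarrow>
     ((nat \<Rightarrow> real) \<Rightarrow> real) \<Rightarrow> (nat set \<Rightarrow> (nat \<Rightarrow> real) \<Rightarrow> real) \<Rightarrow> bool" where
  "generalized_ADD M N X f y yG \<longleftrightarrow>
     (AE \<omega> in M. y (X \<omega>) = (\<Sum>u\<in>Pow {1..N}. yG u (restrict (X \<omega>) u))) \<and>
     (\<forall>u. u \<subseteq> {1..N} \<and> u \<noteq> {} \<longrightarrow>
        yG u \<in> borel_measurable (leb u) \<and>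
        integrable (leb u) (\<lambda>x. (yG u x)\<^sup>2 * marginal_density N f u x) \<and>
        weak_annihilating N f u (yG u))"

end

theory Submission
  imports Defs
begin

text \<open>Let \<open>g\<close> be the component indexed by \<open>u\<close> and \<open>p\<close>
  the marginal density of the coordinates in \<open>u\<close>. Transferring to Lebesgue measure, the
  expectation is the integral of \<open>g * p\<close> over the coordinates in \<open>u\<close>.
  Since \<open>u\<close> is nonempty, some \<open>i\<close> in \<open>u\<close> can be integrated
  out first by Fubini; the weak annihilating condition for this \<open>i\<close> says that the inner
  integral vanishes almost everywhere, so the whole integral is 0
  (\<open>integral_leb_eq_zero\<close>). Two facts make this legitimate. The function
  \<open>p\<close> is a density of the restricted vector
  (\<open>distributed_restrict_marginal_density\<close>, by Tonelli), and \<open>g * p\<close> is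
  integrable, because a square-integrable function on a probability space is integrable.\<close>

interpretation leb: product_sigma_finite "\<lambda>_::nat. lborel :: real measure"
  by standard

lemma sigma_finite_leb: "finite u \<Longrightarrow> sigma_finite_measure (leb u)"
  unfolding leb_def by (rule leb.sigma_finite)

lemma measurable_merge_leb:
  "(\<lambda>(x, z). merge u v (x, z)) \<in> measurable (leb u \<Otimes>\<^sub>M leb v) (leb (u \<union> v))"
  unfolding leb_def by simp

lemma borel_measurable_marginal_density:
  assumes f: "f \<in> borel_measurable (leb {1..N})" and u: "u \<subseteq> {1..N}"
  shows "marginal_density N f u \<in> borel_measurable (leb u)"
proof -
  interpret v: sigma_finite_measure "leb ({1..N} - u)"
    by (rule sigma_finite_leb) simp
  have un: "u \<union> ({1..N} - u) = {1..N}" using u by auto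
  have "(\<lambda>(x, z). f (merge u ({1..N} - u) (x, z)))
      \<in> borel_measurable (leb u \<Otimes>\<^sub>M leb ({1..N} - u))"
    using measurable_compose[OF measurable_merge_leb[of u "{1..N} - u", unfolded un] f]
    by (simp add: case_prod_beta')
  then show ?thesis
    unfolding marginal_density_def by (rule v.borel_measurable_lebesgue_integral)
qed

text \<open>Tonelli identifies the law of the restricted vector, but with an extended-valued
  marginal \<open>m\<close>. The Bochner integral in \<open>marginal_density\<close> takes the
  default value 0 where a section of \<open>f\<close> is not integrable; this can happen only on a
  null set, since \<open>m\<close> has finite total mass.\<close>

lemma distributed_restrict_marginal_density:
  assumes M: "prob_space M"
    and nonneg: "\<And>x. x \<in> space (leb {1..N}) \<Longrightarrow> 0 \<le> f x"
    and dist: "distributed M (leb {1..N}) X (\<lambda>x. ennreal (f x))"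
    and u: "u \<subseteq> {1..N}"
  shows "distributed M (leb u) (\<lambda>\<omega>. restrict (X \<omega>) u)
    (\<lambda>x. ennreal (marginal_density N f u x))"
proof -
  let ?I = "{1..N}" and ?v = "{1..N} - u"
  interpret prob_space M by fact
  interpret v: sigma_finite_measure "leb ?v"
    by (rule sigma_finite_leb) simp
  have fin: "finite u" "finite ?v" "u \<inter> ?v = {}" and un: "u \<union> ?v = ?I"
    using u finite_subset by auto
  have X [measurable]: "X \<in> measurable M (leb ?I)"
    using dist by (rule distributed_measurable)
  have fe: "(\<lambda>x. ennreal (f x)) \<in> borel_measurable (leb ?I)"
    using dist by (rule distributed_borel_measurable)
  \<comment> \<open>The distribution assumption gives measurability only of
    \<open>ennreal (f x)\<close>; nonnegativity on the space lets \<open>enn2real\<close> recover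
    \<open>f\<close>.\<close>
  have "(\<lambda>x. enn2real (ennreal (f x))) \<in> borel_measurable (leb ?I)"
    using fe by measurable
  then have f: "f \<in> borel_measurable (leb ?I)"
    by (rule measurable_cong[THEN iffD1, rotated]) (simp add: nonneg)
  have marg: "marginal_density N f u \<in> borel_measurable (leb u)"
    using f u by (rule borel_measurable_marginal_density)
  have restr: "(\<lambda>x. restrict x u) \<in> measurable (leb ?I) (leb u)"
    unfolding leb_def using u by (rule measurable_restrict_subset)
  have Xu: "(\<lambda>\<omega>. restrict (X \<omega>) u) \<in> measurable M (leb u)"
    using X restr by (rule measurable_compose)
  have merge_x: "(\<lambda>z. merge u ?v (x, z)) \<in> measurable (leb ?v) (leb ?I)"
    if "x \<in> space (leb u)" for x
    using measurable_compose[OF measurable_Pair1'[OF that] measurable_merge_leb[of u ?v, unfolded un]]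
    by simp
  define m where "m x = (\<integral>\<^sup>+z. ennreal (f (merge u ?v (x, z))) \<partial>leb ?v)" for x
  have m: "m \<in> borel_measurable (leb u)"
    unfolding m_def
    by (rule v.borel_measurable_nn_integral)
      (use measurable_compose[OF measurable_merge_leb[of u ?v, unfolded un] fe]
        in \<open>simp add: case_prod_beta'\<close>)
  have fold: "(\<integral>\<^sup>+x. ennreal (f x) * indicator A (restrict x u) \<partial>leb ?I)
      = (\<integral>\<^sup>+x. m x * indicator A x \<partial>leb u)" if A: "A \<in> sets (leb u)" for A
  proof -
    have ind: "(\<lambda>x. indicator A (restrict x u) :: ennreal) \<in> borel_measurable (leb ?I)"
      using measurable_compose[OF restr borel_measurable_indicator[OF A]] .
    have "(\<lambda>x. ennreal (f x) * indicator A (restrict x u))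
        \<in> borel_measurable (Pi\<^sub>M (u \<union> ?v) (\<lambda>_. lborel))"
      using borel_measurable_times_ennreal[OF fe ind] unfolding un leb_def .
    from leb.product_nn_integral_fold[OF fin(3,1,2) this]
    have "(\<integral>\<^sup>+x. ennreal (f x) * indicator A (restrict x u) \<partial>leb ?I)
      = (\<integral>\<^sup>+x. (\<integral>\<^sup>+z. ennreal (f (merge u ?v (x, z))) *
          indicator A (restrict (merge u ?v (x, z)) u) \<partial>leb ?v) \<partial>leb u)"
      unfolding un leb_def .
    also have "\<dots> = (\<integral>\<^sup>+x. m x * indicator A x \<partial>leb u)"
    proof (rule nn_integral_cong)
      fix x assume x: "x \<in> space (leb u)"
      \<comment> \<open>Restricting the merged point to \<open>u\<close> thus gives back
        \<open>x\<close>, so the indicator is constant in \<open>z\<close> and leaves the inner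
        integral.\<close>
      then have "restrict x u = x"
        by (auto simp: leb_def space_PiM PiE_restrict)
      then show "(\<integral>\<^sup>+z. ennreal (f (merge u ?v (x, z))) *
          indicator A (restrict (merge u ?v (x, z)) u) \<partial>leb ?v) = m x * indicator A x"
        using measurable_compose[OF merge_x[OF x] fe]
        by (simp add: m_def nn_integral_multc)
    qed
    finally show ?thesis .
  qed
  have emeas: "emeasure M ((\<lambda>\<omega>. restrict (X \<omega>) u) -` A \<inter> space M)
      = (\<integral>\<^sup>+x. m x * indicator A x \<partial>leb u)" if A: "A \<in> sets (leb u)" for A
  proof -
    \<comment> \<open>The cylinder over \<open>A\<close>: it turns an event about the restricted
      vector into one about \<open>X\<close>, whose density is known.\<close>
    let ?B = "(\<lambda>x. restrict x u) -` A \<inter> space (leb ?I)"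
    have B: "?B \<in> sets (leb ?I)"
      using restr A by (rule measurable_sets)
    have "(\<lambda>\<omega>. restrict (X \<omega>) u) -` A \<inter> space M = X -` ?B \<inter> space M"
      using measurable_space[OF X] by auto
    then have "emeasure M ((\<lambda>\<omega>. restrict (X \<omega>) u) -` A \<inter> space M)
        = (\<integral>\<^sup>+x. ennreal (f x) * indicator ?B x \<partial>leb ?I)"
      using distributed_emeasure[OF dist B] by simp
    also have "\<dots> = (\<integral>\<^sup>+x. ennreal (f x) * indicator A (restrict x u) \<partial>leb ?I)"
      by (intro nn_integral_cong) (auto simp: indicator_def)
    finally show ?thesis using fold[OF A] by simp
  qed
  have "(\<integral>\<^sup>+x. m x \<partial>leb u) = (\<integral>\<^sup>+x. m x * indicator (space (leb u)) x \<partial>leb u)"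
    by (intro nn_integral_cong) simp
  \<comment> \<open>The total mass of \<open>m\<close> is the probability of the whole sample
    space.\<close>
  also have "\<dots> \<noteq> \<infinity>"
    using emeas[OF sets.top] by (metis emeasure_finite infinity_ennreal_def)
  finally have "AE x in leb u. m x \<noteq> \<infinity>"
    by (rule nn_integral_PInf_AE[OF m])
  then have AE_m: "AE x in leb u. m x = ennreal (marginal_density N f u x)"
  proof (rule AE_mp, intro AE_I2 impI)
    fix x assume x: "x \<in> space (leb u)" and "m x \<noteq> \<infinity>"
    moreover have "0 \<le> f (merge u ?v (x, z))" if "z \<in> space (leb ?v)" for z
      by (rule nonneg) (rule measurable_space[OF merge_x[OF x] that])
    moreover have "(\<lambda>z. f (merge u ?v (x, z))) \<in> borel_measurable (leb ?v)"
      using measurable_compose[OF merge_x[OF x] f] .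
    \<comment> \<open>For a nonnegative measurable section with finite integral, the Bochner and the
      nonnegative integral agree.\<close>
    ultimately show "m x = ennreal (marginal_density N f u x)"
      unfolding m_def marginal_density_def
      by (subst integral_eq_nn_integral)
        (auto intro!: AE_I2 simp: less_top)
  qed
  have "distr M (leb u) (\<lambda>\<omega>. restrict (X \<omega>) u) = density (leb u) m"
  proof (rule measure_eqI)
    fix A assume "A \<in> sets (distr M (leb u) (\<lambda>\<omega>. restrict (X \<omega>) u))"
    then have A: "A \<in> sets (leb u)" by simp
    show "emeasure (distr M (leb u) (\<lambda>\<omega>. restrict (X \<omega>) u)) A = emeasure (density (leb u) m) A"
      using emeas[OF A] by (simp add: emeasure_distr[OF Xu A] emeasure_density[OF m A])
  qed simp
  also have "\<dots> = density (leb u) (\<lambda>x. ennreal (marginal_density N f u x))"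
    using m _ AE_m by (rule density_cong) (use marg in measurable)
  finally show ?thesis
    unfolding distributed_def using Xu marg by simp
qed

text \<open>Fubini, with coordinate \<open>i\<close> innermost; integrability of \<open>g\<close> on
  the full product justifies the iterated integral.\<close>

lemma integral_leb_eq_zero:
  fixes g :: "(nat \<Rightarrow> real) \<Rightarrow> real"
  assumes "finite u" "i \<in> u" and g: "integrable (leb u) g"
    and zero: "AE x in leb (u - {i}). (\<integral>t. g (x(i := t)) \<partial>lborel) = 0"
  shows "integral\<^sup>L (leb u) g = 0"
proof -
  have u: "insert i (u - {i}) = u" using assms(2) by auto
  have "integral\<^sup>L (leb u) g = (\<integral>x. (\<integral>t. g (x(i := t)) \<partial>lborel) \<partial>leb (u - {i}))"
    using leb.product_integral_insert[of "u - {i}" i g] assms(1) g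
    unfolding u leb_def by simp
  also have "\<dots> = 0"
    using zero by (rule integral_eq_zero_AE)
  finally show ?thesis .
qed

theorem proposition4p1:
  fixes M :: "'a measure"
    and N :: nat
    and X :: "'a \<Rightarrow> nat \<Rightarrow> real"
    and f y :: "(nat \<Rightarrow> real) \<Rightarrow> real"
    and yG :: "nat set \<Rightarrow> (nat \<Rightarrow> real) \<Rightarrow> real"
    and u :: "nat set"
  assumes "prob_space M" and "complete_measure M"
    and "\<And>x. x \<in> space (leb {1..N}) \<Longrightarrow> 0 \<le> f x"
    and "distributed M (leb {1..N}) X (\<lambda>x. ennreal (f x))"
    and "grid_closed N (density_support N f)"
    and "square_integrable_function M N X y"
    and "generalized_ADD M N X f y yG"
    and "u \<noteq> {}" and "u \<subseteq> {1..N}"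
  shows "integrable M (\<lambda>\<omega>. yG u (restrict (X \<omega>) u)) \<and>
         prob_space.expectation M (\<lambda>\<omega>. yG u (restrict (X \<omega>) u)) = 0"
proof -
  interpret prob_space M by fact
  let ?g = "yG u" and ?p = "marginal_density N f u"
  let ?Xu = "\<lambda>\<omega>. restrict (X \<omega>) u"
  have g: "?g \<in> borel_measurable (leb u)"
    and sq: "integrable (leb u) (\<lambda>x. (?g x)\<^sup>2 * ?p x)"
    and wa: "weak_annihilating N f u ?g"
    using assms(7-9) unfolding generalized_ADD_def by blast+
  have dist: "distributed M (leb u) ?Xu (\<lambda>x. ennreal (?p x))"
    using assms(1,3,4,9) by (rule distributed_restrict_marginal_density)
  \<comment> \<open>This holds at every point, including those where the section is not integrable
    and the integral defaults to 0.\<close>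
  have p: "0 \<le> ?p x" if "x \<in> space (leb u)" for x
    unfolding marginal_density_def
  proof (rule integral_nonneg_AE, rule AE_I2)
    fix z assume "z \<in> space (leb ({1..N} - u))"
    with that assms(9) show "0 \<le> f (merge u ({1..N} - u) (x, z))"
      by (intro assms(3)) (auto simp: leb_def space_PiM PiE_iff merge_def extensional_def)
  qed
  have "integrable M (\<lambda>\<omega>. (?g (?Xu \<omega>))\<^sup>2)"
    using distributed_integrable[OF dist, of "\<lambda>x. (?g x)\<^sup>2"] g sq p
    by (simp add: mult.commute)
  \<comment> \<open>Square integrability implies integrability here because \<open>M\<close> is a
    finite measure.\<close>
  then have int: "integrable M (\<lambda>\<omega>. ?g (?Xu \<omega>))"
    by (rule square_integrable_imp_integrable[rotated])
      (rule measurable_compose[OF distributed_measurable[OF dist] g])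
  \<comment> \<open>Back from \<open>M\<close> to Lebesgue measure, where Fubini is applied.\<close>
  have gp: "integrable (leb u) (\<lambda>x. ?g x * ?p x)"
    using distributed_integrable[OF dist g] p int by (simp add: mult.commute)
  obtain i where i: "i \<in> u" using assms(8) by blast
  have "(\<integral>x. ?g x * ?p x \<partial>leb u) = 0"
    using finite_subset[OF assms(9)] i gp wa
    by (intro integral_leb_eq_zero) (auto simp: weak_annihilating_def)
  then have "expectation (\<lambda>\<omega>. ?g (?Xu \<omega>)) = 0"
    using distributed_integral[OF dist g] p by (simp add: mult.commute)
  with int show ?thesis by simp
qed

end
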